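(* For $0\le r\le n$, the average depth of the $r$th leaf over all increasing binary trees of size $n$ equals $$H_r+H_{n-r},$$ where $H_k=\sum_{i=1}^k \frac{1}{i}$ is the $k$th harmonic number.
   Context: A binary tree here means a complete binary tree: a rooted tree where each internal (non-leaf) node has a left child and a right child (the single-node tree is allowed). An increasing binary tree of size $n$ is a binary tree with $n$ internal nodes labeled with the distinct labels $1,2,\dots,n$ in such a way that labels increase when moving away from the root (leaves are unlabeled); there are $n!$ of them. Its $n+1$ leaves are indexed $0,1,\dots,n$ from left to right. The depth of a leaf is the number of edges in the path from the root to it. The average is over the uniform distribution. *)

theory Defs
  imports "HOL-Probability.Probability" "HOL-Library.Tree"
begin

text \<open>
  In \<^typ>\<open>'a tree\<close> every \<^const>\<open>Node\<close> has exactly a left and a right child, so these are the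
  complete binary trees (each internal node has two children), with labels on the internal nodes
  only and unlabelled leaves. \<^term>\<open>size t\<close> is the number of internal nodes of \<open>t\<close>.
  This is unrelated to \<^const>\<open>Tree.complete\<close>, which asks all leaves to have the same depth.
\<close>

fun increasing :: "nat tree \<Rightarrow> bool" where
  "increasing Leaf \<longleftrightarrow> True"
| "increasing (Node l a r) \<longleftrightarrow>
     (\<forall>b \<in> set_tree l \<union> set_tree r. a < b) \<and> increasing l \<and> increasing r"

text \<open>
  As \<^term>\<open>inorder t\<close> lists the labels of all internal nodes, with multiplicity, its distinctness
  says that every label is used once.
\<close>

definition increasing_trees :: "nat \<Rightarrow> nat tree set" where
  "increasing_trees n =
     {t. size t = n \<and> set_tree t = {1..n} \<and> distinct (inorder t) \<and> increasing t}"

text \<open>The depths of all leaves, listed from left to right.\<close>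

fun leaf_depths :: "'a tree \<Rightarrow> nat list" where
  "leaf_depths Leaf = [0]"
| "leaf_depths (Node l a r) = map Suc (leaf_depths l @ leaf_depths r)"

definition leaf_depth :: "'a tree \<Rightarrow> nat \<Rightarrow> nat" where
  "leaf_depth t r = leaf_depths t ! r"

lemma length_leaf_depths [simp]: "length (leaf_depths t) = size t + 1"
  by (induction t) auto

text \<open>
  Finiteness and non-emptiness make \<^term>\<open>pmf_of_set (increasing_trees n)\<close> the uniform distribution.
\<close>

lemma finite_increasing_trees: "finite (increasing_trees n)"
proof -
  have "finite {t :: nat tree. size t \<le> k \<and> set_tree t \<subseteq> {1..n}}" (is "finite (?T k)") for k
  proof (induction k)
    case 0
    have "?T 0 \<subseteq> {Leaf}" by auto
    then show ?case by (rule finite_subset) simp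
  next
    case (Suc k)
    have "?T (Suc k) \<subseteq> insert Leaf ((\<lambda>(l, a, r). Node l a r) ` (?T k \<times> {1..n} \<times> ?T k))"
    proof
      fix t :: "nat tree"
      assume "t \<in> ?T (Suc k)"
      then show "t \<in> insert Leaf ((\<lambda>(l, a, r). Node l a r) ` (?T k \<times> {1..n} \<times> ?T k))"
        by (cases t) force+
    qed
    then show ?case by (rule finite_subset) (use Suc in auto)
  qed
  from this[of n] show ?thesis
    by (rule rev_finite_subset) (auto simp: increasing_trees_def)
qed

lemma increasing_trees_nonempty: "increasing_trees n \<noteq> {}"
proof -
  have "\<exists>t. size t = k \<and> set_tree t = {m + 1..m + k} \<and> distinct (inorder t) \<and> increasing t"
    for k m
  proof (induction k arbitrary: m)
    case 0
    show ?case by (rule exI[of _ Leaf]) simp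
  next
    case (Suc k)
    then obtain t where t: "size t = k" "set_tree t = {Suc m + 1..Suc m + k}"
      "distinct (inorder t)" "increasing t" by blast
    then have "set_tree (Node Leaf (Suc m) t) = {m + 1..m + Suc k}" by auto
    then show ?case using t by (intro exI[of _ "Node Leaf (Suc m) t"]) auto
  qed
  from this[of n 0] show ?thesis by (auto simp: increasing_trees_def)
qed

end

theory Submission
  imports Defs
begin

text \<open>
  In an increasing tree the largest label sits at a node both of whose children are leaves. Deleting
  that node therefore leaves a leaf behind, and an increasing tree of size \<open>n + 1\<close> is the same thing
  as an increasing tree of size \<open>n\<close> together with one of its \<open>n + 1\<close> leaves, at which the node
  labelled \<open>n + 1\<close> is attached (\<open>bij_betw_grow\<close>). Attaching it at leaf \<open>i\<close> replaces this leaf by two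
  leaves that are one level deeper, shifts the leaves to its right by one position, and changes no
  other depth (\<open>leaf_depth_grow\<close>).

  Hence leaf \<open>r\<close> of the new tree is leaf \<open>r - 1\<close> of the old one for the \<open>r\<close> choices \<open>i < r\<close>, one
  level deeper if \<open>i = r - 1\<close>, and it is leaf \<open>r\<close> of the old one for the \<open>n + 1 - r\<close> choices
  \<open>i \<ge> r\<close>, one level deeper if \<open>i = r\<close>. So the average depth \<open>A n r\<close> satisfies
  \<open>(n + 1) * A (n + 1) r = r * A n (r - 1) + (n + 1 - r) * A n r + [r \<ge> 1] + [r \<le> n]\<close>.
  The numbers \<open>H r + H (n - r)\<close> satisfy the same recurrence, because the two brackets are precisely
  \<open>r * (H r - H (r - 1))\<close> and \<open>(n + 1 - r) * (H (n + 1 - r) - H (n - r))\<close>.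
\<close>

section \<open>Attaching a node at a leaf\<close>

text \<open>
  The leaf to be replaced is given by its position from the left. A left subtree \<open>l\<close> has
  \<open>size l + 1\<close> leaves, numbered \<open>0\<close> to \<open>size l\<close>.
\<close>

fun grow :: "nat \<Rightarrow> 'a \<Rightarrow> 'a tree \<Rightarrow> 'a tree" where
  "grow i m Leaf = Node Leaf m Leaf"
| "grow i m (Node l a r) =
     (if i \<le> size l then Node (grow i m l) a r else Node l a (grow (i - Suc (size l)) m r))"

lemma size_grow [simp]: "size (grow i m t) = Suc (size t)"
  by (induction i m t rule: grow.induct) auto

lemma set_tree_grow [simp]: "set_tree (grow i m t) = insert m (set_tree t)"
  by (induction i m t rule: grow.induct) auto

text \<open>
  Besides deciding whether the labels of a grown tree are distinct, this lets the leaf \<open>i\<close> be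
  recovered as the position of the new label.
\<close>

lemma inorder_grow:
  "i \<le> size t \<Longrightarrow> inorder (grow i m t) = take i (inorder t) @ m # drop i (inorder t)"
  by (induction i m t rule: grow.induct) (auto simp: take_Cons' drop_Cons')

lemma distinct_inorder_grow:
  assumes "i \<le> size t"
  shows "distinct (inorder (grow i m t)) \<longleftrightarrow> m \<notin> set_tree t \<and> distinct (inorder t)"
proof -
  have "distinct (xs @ m # ys) \<longleftrightarrow> m \<notin> set (xs @ ys) \<and> distinct (xs @ ys)" for xs ys
    by auto
  from this[of "take i (inorder t)" "drop i (inorder t)"] show ?thesis
    unfolding inorder_grow[OF assms] by simp
qed

lemma increasing_grow:
  "\<forall>b \<in> set_tree t. b < m \<Longrightarrow> increasing (grow i m t) \<longleftrightarrow> increasing t"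
  by (induction i m t rule: grow.induct) auto

fun prune :: "'a \<Rightarrow> 'a tree \<Rightarrow> 'a tree" where
  "prune m Leaf = Leaf"
| "prune m (Node l a r) = (if a = m then Leaf else Node (prune m l) a (prune m r))"

lemma prune_idle: "m \<notin> set_tree t \<Longrightarrow> prune m t = t"
  by (induction t) auto

lemma prune_grow: "m \<notin> set_tree t \<Longrightarrow> prune m (grow i m t) = t"
  by (induction i m t rule: grow.induct) (auto simp: prune_idle)

lemma grow_inject:
  assumes "grow i m s = grow j m t" "i \<le> size s" "j \<le> size t" "m \<notin> set_tree s" "m \<notin> set_tree t"
  shows "i = j \<and> s = t"
proof -
  have st: "s = t"
    using prune_grow[OF assms(4), of i] prune_grow[OF assms(5), of j] assms(1) by simp
  have "takeWhile (\<lambda>x. x \<noteq> m) (inorder (grow k m t)) = take k (inorder t)" if "k \<le> size t" for k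
    using that assms(5) by (auto simp: inorder_grow takeWhile_append dest: in_set_takeD)
  then have "take i (inorder t) = take j (inorder t)"
    using st assms(1) assms(2)[unfolded st] assms(3) by metis
  then have "length (take i (inorder t)) = length (take j (inorder t))"
    by simp
  then show ?thesis
    using assms st by simp
qed

text \<open>
  A node carrying the largest label has no internal nodes below it, as their labels would have to be
  larger still; so it can be cut off as a whole.
\<close>

lemma grow_of_max_label:
  assumes "increasing t" "distinct (inorder t)" "m \<in> set_tree t" "\<forall>b \<in> set_tree t. b \<le> m"
  shows "\<exists>i s. t = grow i m s \<and> i \<le> size s \<and> m \<notin> set_tree s"
  using assms
proof (induction t)
  case Leaf
  then show ?case by simp
next
  case (Node l a r)
  consider "a = m" | "a \<noteq> m" "m \<in> set_tree l" | "a \<noteq> m" "m \<in> set_tree r"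
    using Node.prems by auto
  then show ?case
  proof cases
    case 1
    have "b \<notin> set_tree l \<union> set_tree r" for b
      using Node.prems(1,4) 1 by (auto simp flip: not_less)
    then have "set_tree l = {}" "set_tree r = {}"
      by blast+
    then have "Node l a r = grow 0 m Leaf"
      using 1 by simp
    then show ?thesis
      by (intro exI[of _ 0] exI[of _ Leaf]) simp
  next
    case 2
    then obtain i s where "l = grow i m s" "i \<le> size s" "m \<notin> set_tree s"
      using Node.IH(1) Node.prems(1,2,4) by auto
    moreover have "m \<notin> set_tree r"
      using Node.prems(2) 2 by auto
    ultimately have "Node l a r = grow i m (Node s a r)" "i \<le> size (Node s a r)"
      "m \<notin> set_tree (Node s a r)"
      using 2(1) by simp_all
    then show ?thesis by blast
  next
    case 3
    then obtain i s where "r = grow i m s" "i \<le> size s" "m \<notin> set_tree s"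
      using Node.IH(2) Node.prems(1,2,4) by auto
    moreover have "m \<notin> set_tree l"
      using Node.prems(2) 3 by auto
    ultimately have "Node l a r = grow (i + Suc (size l)) m (Node l a s)"
      "i + Suc (size l) \<le> size (Node l a s)" "m \<notin> set_tree (Node l a s)"
      using 3(1) by simp_all
    then show ?thesis by blast
  qed
qed

lemma grow_in_increasing_trees_iff:
  assumes "i \<le> size t" "Suc n \<notin> set_tree t"
  shows "grow i (Suc n) t \<in> increasing_trees (Suc n) \<longleftrightarrow> t \<in> increasing_trees n"
proof -
  have "{1..Suc n} = insert (Suc n) {1..n}"
    by auto
  then have set: "set_tree (grow i (Suc n) t) = {1..Suc n} \<longleftrightarrow> set_tree t = {1..n}"
    using assms(2) by (simp only: set_tree_grow) (rule insert_ident, simp_all)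
  have inc: "increasing (grow i (Suc n) t) \<longleftrightarrow> increasing t" if "set_tree t = {1..n}"
    by (rule increasing_grow) (simp add: that)
  show ?thesis
    unfolding increasing_trees_def mem_Collect_eq size_grow set nat.inject
      distinct_inorder_grow[OF assms(1)]
    using inc assms(2) by blast
qed

lemma bij_betw_grow:
  "bij_betw (\<lambda>(t, i). grow i (Suc n) t) (increasing_trees n \<times> {..n}) (increasing_trees (Suc n))"
proof (rule bij_betw_imageI)
  have leaf: "i \<le> size t" "Suc n \<notin> set_tree t" if "(t, i) \<in> increasing_trees n \<times> {..n}" for t i
    using that by (simp_all add: increasing_trees_def)
  show "inj_on (\<lambda>(t, i). grow i (Suc n) t) (increasing_trees n \<times> {..n})"
  proof (rule inj_onI)
    fix p q
    assume p: "p \<in> increasing_trees n \<times> {..n}" and q: "q \<in> increasing_trees n \<times> {..n}"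
      and eq: "(\<lambda>(t, i). grow i (Suc n) t) p = (\<lambda>(t, i). grow i (Suc n) t) q"
    obtain s i t j where st: "p = (s, i)" "q = (t, j)"
      by (metis surj_pair)
    from grow_inject[OF _ leaf(1)[OF p[unfolded st]] leaf(1)[OF q[unfolded st]]
        leaf(2)[OF p[unfolded st]] leaf(2)[OF q[unfolded st]]]
    show "p = q"
      using eq by (simp add: st)
  qed
  show "(\<lambda>(t, i). grow i (Suc n) t) ` (increasing_trees n \<times> {..n}) = increasing_trees (Suc n)"
  proof (intro subset_antisym image_subsetI subsetI)
    fix p assume p: "p \<in> increasing_trees n \<times> {..n}"
    then obtain t i where ti: "p = (t, i)" "t \<in> increasing_trees n"
      by blast
    then show "(case p of (t, i) \<Rightarrow> grow i (Suc n) t) \<in> increasing_trees (Suc n)"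
      using grow_in_increasing_trees_iff[OF leaf[OF p[unfolded ti(1)]]] by simp
  next
    fix t assume t: "t \<in> increasing_trees (Suc n)"
    then have "\<exists>i s. t = grow i (Suc n) s \<and> i \<le> size s \<and> Suc n \<notin> set_tree s"
      by (intro grow_of_max_label) (simp_all add: increasing_trees_def)
    then obtain i s where s: "t = grow i (Suc n) s" "i \<le> size s" "Suc n \<notin> set_tree s"
      by blast
    then have "s \<in> increasing_trees n"
      using t grow_in_increasing_trees_iff by blast
    moreover from this have "i \<le> n"
      using s(2) by (simp add: increasing_trees_def)
    ultimately have "(s, i) \<in> increasing_trees n \<times> {..n}"
      by simp
    then show "t \<in> (\<lambda>(t, i). grow i (Suc n) t) ` (increasing_trees n \<times> {..n})"
      by (rule image_eqI[rotated]) (simp add: s(1))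
  qed
qed

section \<open>Total leaf depths\<close>

lemma card_increasing_trees: "card (increasing_trees n) = fact n"
proof (induction n)
  case 0
  have "increasing_trees 0 = {Leaf}"
    by (auto simp: increasing_trees_def)
  then show ?case by simp
next
  case (Suc n)
  then show ?case
    using bij_betw_same_card[OF bij_betw_grow[of n], symmetric]
    by (simp add: card_cartesian_product)
qed

lemma leaf_depths_grow:
  "i \<le> size t \<Longrightarrow> leaf_depths (grow i m t) =
     take i (leaf_depths t) @ replicate 2 (Suc (leaf_depths t ! i)) @ drop (Suc i) (leaf_depths t)"
proof (induction i m t rule: grow.induct)
  case (2 i m l a r)
  show ?case
  proof (cases "i \<le> size l")
    case True
    then show ?thesis
      using 2 by (simp add: numeral_2_eq_2 nth_append take_map drop_map)
  next
    case False
    then obtain j where "i = Suc (size l) + j"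
      using nat_le_iff_add[of "Suc (size l)" i] by auto
    then show ?thesis
      using 2 by (simp add: numeral_2_eq_2 nth_append take_map drop_map)
  qed
qed (simp add: numeral_2_eq_2)

text \<open>The new leaves take positions \<open>i\<close> and \<open>i + 1\<close>, and both originate from the old leaf \<open>i\<close>.\<close>

lemma leaf_depth_grow:
  assumes "i \<le> size t" "r \<le> Suc (size t)"
  shows "leaf_depth (grow i m t) r =
    (if i < r then leaf_depth t (r - 1) + of_bool (i = r - 1) else leaf_depth t r + of_bool (i = r))"
proof -
  consider "r \<le> i" | "r = Suc i" | j where "r = Suc (Suc (i + j))"
    using nat_le_iff_add[of "Suc (Suc i)" r] by fastforce
  then show ?thesis
    using assms unfolding leaf_depth_def leaf_depths_grow[OF assms(1)]
    by cases (auto simp: nth_append numeral_2_eq_2 nth_Cons')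
qed

lemma sum_leaf_depth_grow:
  assumes "size t = n" "r \<le> Suc n"
  shows "(\<Sum>i\<le>n. leaf_depth (grow i m t) r) =
    r * leaf_depth t (r - 1) + (Suc n - r) * leaf_depth t r + of_bool (0 < r) + of_bool (r \<le> n)"
proof -
  have "{..n} = {..<r} \<union> {r..n}"
    using assms by auto
  then have "(\<Sum>i\<le>n. leaf_depth (grow i m t) r) =
      (\<Sum>i<r. leaf_depth (grow i m t) r) + (\<Sum>i=r..n. leaf_depth (grow i m t) r)"
    by (simp add: sum.union_disjoint ivl_disj_int)
  also have "(\<Sum>i<r. leaf_depth (grow i m t) r) =
      (\<Sum>i<r. leaf_depth t (r - 1) + of_bool (i = r - 1))"
    using assms by (intro sum.cong) (auto simp: leaf_depth_grow)
  also have "\<dots> = r * leaf_depth t (r - 1) + of_bool (0 < r)"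
    by (simp add: sum.distrib of_bool_def)
  also have "(\<Sum>i=r..n. leaf_depth (grow i m t) r) = (\<Sum>i=r..n. leaf_depth t r + of_bool (i = r))"
    using assms by (intro sum.cong) (auto simp: leaf_depth_grow)
  also have "\<dots> = (Suc n - r) * leaf_depth t r + of_bool (r \<le> n)"
    by (simp add: sum.distrib of_bool_def)
  finally show ?thesis by simp
qed

lemma total_leaf_depth_Suc:
  assumes "r \<le> Suc n"
  shows "(\<Sum>t\<in>increasing_trees (Suc n). leaf_depth t r) =
    r * (\<Sum>t\<in>increasing_trees n. leaf_depth t (r - 1)) +
    (Suc n - r) * (\<Sum>t\<in>increasing_trees n. leaf_depth t r) +
    fact n * (of_bool (0 < r) + of_bool (r \<le> n))"
proof -
  have "(\<Sum>t\<in>increasing_trees (Suc n). leaf_depth t r) =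
      (\<Sum>(t, i)\<in>increasing_trees n \<times> {..n}. leaf_depth (grow i (Suc n) t) r)"
    using sum.reindex_bij_betw[OF bij_betw_grow[of n], of "\<lambda>t. leaf_depth t r"]
    by (simp add: case_prod_unfold)
  also have "\<dots> = (\<Sum>t\<in>increasing_trees n. \<Sum>i\<le>n. leaf_depth (grow i (Suc n) t) r)"
    by (simp add: sum.cartesian_product)
  also have "\<dots> = (\<Sum>t\<in>increasing_trees n. r * leaf_depth t (r - 1) +
      (Suc n - r) * leaf_depth t r + (of_bool (0 < r) + of_bool (r \<le> n)))"
    using assms
    by (intro sum.cong) (auto simp: sum_leaf_depth_grow increasing_trees_def)
  finally show ?thesis
    by (simp only: sum.distrib sum_distrib_left sum_constant card_increasing_trees of_nat_id
        distrib_left)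
qed

text \<open>
  Read from right to left, this absorbs the extra levels gained by splitting a leaf into the
  harmonic numbers.
\<close>

lemma of_nat_mult_harm:
  "real k * harm k = real k * harm (k - 1) + of_bool (0 < k)"
  by (cases k) (auto simp: harm_Suc field_simps)

lemma total_leaf_depth:
  "r \<le> n \<Longrightarrow> real (\<Sum>t\<in>increasing_trees n. leaf_depth t r) = fact n * (harm r + harm (n - r))"
proof (induction n arbitrary: r)
  case 0
  have "increasing_trees 0 = {Leaf}"
    by (auto simp: increasing_trees_def)
  with 0 show ?case
    by (simp add: leaf_depth_def harm_def)
next
  case (Suc n)
  define k where "k = Suc n - r"
  have k: "real n + 1 = real r + real k" "n - (r - 1) = k \<or> r = 0" "n - r = k - 1"
    "(r \<le> n) = (0 < k)"
    using Suc.prems by (auto simp: k_def)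
  \<comment> \<open>The factors \<open>r\<close> and \<open>k\<close> vanish where the indices \<open>r - 1\<close> and \<open>r\<close> leave the range of the
    induction hypothesis.\<close>
  have left: "real r * real (\<Sum>t\<in>increasing_trees n. leaf_depth t (r - 1)) =
      real r * (fact n * (harm (r - 1) + harm k))"
    using Suc.IH[of "r - 1"] Suc.prems k by (cases "r = 0") auto
  have right: "real k * real (\<Sum>t\<in>increasing_trees n. leaf_depth t r) =
      real k * (fact n * (harm r + harm (k - 1)))"
    using Suc.IH[of r] k by (cases "k = 0") auto
  have "real (\<Sum>t\<in>increasing_trees (Suc n). leaf_depth t r) =
      real r * real (\<Sum>t\<in>increasing_trees n. leaf_depth t (r - 1)) +
      real k * real (\<Sum>t\<in>increasing_trees n. leaf_depth t r) +
      fact n * (of_bool (0 < r) + of_bool (0 < k))"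
    unfolding total_leaf_depth_Suc[OF Suc.prems] k(4) k_def[symmetric]
    by (simp only: of_nat_add of_nat_mult of_nat_fact of_nat_of_bool)
  also have "\<dots> = fact n * ((real r * harm (r - 1) + of_bool (0 < r)) + real r * harm k +
      real k * harm r + (real k * harm (k - 1) + of_bool (0 < k)))"
    unfolding left right by (simp only: algebra_simps)
  also have "\<dots> = fact n * ((real r + real k) * (harm r + harm k))"
    unfolding of_nat_mult_harm[symmetric] by (simp only: algebra_simps)
  also have "\<dots> = fact (Suc n) * (harm r + harm k)"
    unfolding k(1)[symmetric] by (simp add: ac_simps)
  finally show ?case
    by (simp only: k_def)
qed

theorem theorem7p2:
  fixes n r :: nat
  assumes "r \<le> n"
  shows "measure_pmf.expectation (pmf_of_set (increasing_trees n)) (\<lambda>t. real (leaf_depth t r))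
           = harm r + harm (n - r)"
  using total_leaf_depth[OF assms]
  by (simp add: integral_pmf_of_set finite_increasing_trees increasing_trees_nonempty
      card_increasing_trees)

end
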